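(* The positive range $\mathcal{H}^+$ has natural density zero: $$\lim_{x\to\infty}\frac{I(x)}{x}=0.$$
   Context: $p(n)$ denotes the number of (unrestricted) partitions of the positive integer $n$, and $H(n):=p(n)-n$. The positive range is $\mathcal{H}^+:=\{H(n):n\ge 4\}$, regarded as a set of positive integers. For real $x$, $I(x):=\#\{m\in\mathcal{H}^+: m\le x\}$. *)

theory Defs
  imports Complex_Main "HOL-Library.Multiset"
begin

text \<open>A partition of \<open>n\<close> is a finite multiset of positive integers with sum \<open>n\<close>. For each \<open>n\<close>
  there are only finitely many of them, so \<open>card\<close> below is a genuine count.\<close>

definition partitions_of :: "nat \<Rightarrow> nat multiset set" where
  "partitions_of n = {M. (\<forall>k\<in>#M. k > 0) \<and> \<Sum>\<^sub># M = n}"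

definition p :: "nat \<Rightarrow> nat" where
  "p n = card (partitions_of n)"

definition H :: "nat \<Rightarrow> int" where
  "H n = int (p n) - int n"

text \<open>All elements are positive, because \<open>p n > n\<close> for \<open>n \<ge> 4\<close>; in particular only finitely
  many of them lie below a given real bound.\<close>

definition Hpos :: "int set" where
  "Hpos = {H n |n. n \<ge> 4}"

definition I :: "real \<Rightarrow> nat" where
  "I x = card {m \<in> Hpos. real_of_int m \<le> x}"

end

theory Submission
  imports Defs "HOL-Real_Asymp.Real_Asymp"
begin

text \<open>Partitions with parts 1, 2 and 3 alone give quadratic growth of \<^term>\<open>p\<close>, hence
  \<^term>\<open>I x\<close> is of order at most the square root of \<^term>\<open>x\<close>.\<close>

text \<open>Removing one part \<open>k\<close> from a nonempty partition leaves a partition of the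
  smaller number \<open>n - k\<close>. Finiteness matters because \<open>card\<close> is 0 on
  infinite sets.\<close>

lemma finite_partitions_of: "finite (partitions_of n)"
proof (induction n rule: less_induct)
  case (less n)
  have "partitions_of n \<subseteq> insert {#} (\<Union>k\<in>{1..n}. add_mset k ` partitions_of (n - k))"
  proof
    fix M assume M: "M \<in> partitions_of n"
    show "M \<in> insert {#} (\<Union>k\<in>{1..n}. add_mset k ` partitions_of (n - k))"
    proof (cases M)
      case (add k N)
      with M have "k \<in> {1..n}" "N \<in> partitions_of (n - k)"
        by (auto simp: partitions_of_def)
      then show ?thesis using add by blast
    qed simp
  qed
  moreover have "finite (insert {#} (\<Union>k\<in>{1..n}. add_mset k ` partitions_of (n - k)))"
    using less by simp
  ultimately show ?case by (rule finite_subset)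
qed

text \<open>Up to \<open>n div 5\<close> twos and, independently, as many threes use at most
  \<open>5 * (n div 5)\<close> \<le> \<open>n\<close>; ones fill the rest, so the subtraction in
  \<open>f\<close> never truncates on \<open>?A\<close>.\<close>

lemma p_ge_square: "(n div 5 + 1)\<^sup>2 \<le> p n"
proof -
  define f where "f = (\<lambda>(a, b). replicate_mset a 2 + replicate_mset b 3
    + replicate_mset (n - (2 * a + 3 * b)) (1::nat))"
  let ?A = "{..n div 5} \<times> {..n div 5}"
  \<comment> \<open>The multiplicities of 2 and 3 recover the pair.\<close>
  have "count (f (a, b)) 2 = a" "count (f (a, b)) 3 = b" for a b
    by (simp_all add: f_def)
  then have "inj_on f ?A"
    by (intro inj_onI) (metis surj_pair)
  moreover have "f ` ?A \<subseteq> partitions_of n"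
    by (auto simp: f_def partitions_of_def split: if_splits)
  ultimately have "card ?A \<le> card (partitions_of n)"
    using card_inj_on_le finite_partitions_of by blast
  then show ?thesis by (simp add: p_def power2_eq_square)
qed

text \<open>The bound \<open>p n\<close> \<ge> n^2/25 outweighs the subtracted \<open>n\<close>:
  \<open>H n\<close> \<le> \<open>x\<close> gives n(n - 25) \<le> 25x.\<close>

lemma le_sqrt_if_H_le:
  assumes "real_of_int (H n) \<le> x" and "x \<ge> 0"
  shows "real n \<le> 25 + 5 * sqrt x"
proof (rule ccontr)
  assume "\<not> real n \<le> 25 + 5 * sqrt x"
  then have n: "real n - 25 > 5 * sqrt x" by simp
  have "n \<le> 5 * (n div 5 + 1)" by presburger
  then have "n\<^sup>2 \<le> (5 * (n div 5 + 1))\<^sup>2" by (rule power_mono) simp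
  also have "\<dots> = 25 * (n div 5 + 1)\<^sup>2" unfolding power_mult_distrib by simp
  also have "\<dots> \<le> 25 * p n" using p_ge_square by simp
  finally have "real (n\<^sup>2) \<le> real (25 * p n)" by (rule of_nat_mono)
  then have "(real n)\<^sup>2 \<le> 25 * real (p n)" by simp
  with assms(1) have "real n * (real n - 25) \<le> 25 * x"
    by (simp add: H_def algebra_simps power2_eq_square)
  \<comment> \<open>Both factors on the right exceed \<open>5 * sqrt x\<close>, so their product
    exceeds 25x.\<close>
  moreover have "5 * sqrt x * (5 * sqrt x) < real n * (real n - 25)"
    using n assms(2) by (intro mult_strict_mono') auto
  ultimately show False using assms(2) by simp
qed

lemma I_le_sqrt:
  assumes "x \<ge> 0"
  shows "real (I x) \<le> 26 + 5 * sqrt x"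
proof -
  let ?N = "nat \<lfloor>25 + 5 * sqrt x\<rfloor>"
  have "{m \<in> Hpos. real_of_int m \<le> x} \<subseteq> H ` {..?N}"
    using le_sqrt_if_H_le[OF _ assms] unfolding Hpos_def by (blast intro: le_nat_floor)
  \<comment> \<open>Coinciding values of \<open>H\<close> only lower the count. The index 0 is
    included, giving \<open>?N + 1\<close> indices and hence 26 in place of 25.\<close>
  then have "I x \<le> card {..?N}"
    unfolding I_def by (meson card_image_le card_mono finite_atMost finite_imageI le_trans)
  moreover have "real ?N \<le> 25 + 5 * sqrt x"
    using assms by (intro of_nat_floor) simp
  ultimately show ?thesis by simp
qed

theorem corollary5p3:
  shows "((\<lambda>x::real. real (I x) / x) \<longlongrightarrow> 0) at_top"
proof (rule tendsto_sandwich)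
  show "\<forall>\<^sub>F x in at_top. 0 \<le> real (I x) / x"
    using eventually_ge_at_top[of 0] by eventually_elim simp
  \<comment> \<open>At \<open>x = 0\<close> both quotients are 0 by convention.\<close>
  show "\<forall>\<^sub>F x in at_top. real (I x) / x \<le> (26 + 5 * sqrt x) / x"
    using eventually_ge_at_top[of 0] by eventually_elim (intro divide_right_mono I_le_sqrt)
  show "((\<lambda>x::real. (26 + 5 * sqrt x) / x) \<longlongrightarrow> 0) at_top"
    by real_asymp
qed simp

end
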